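(* Let $k,l\ge 0$ be integers. Let $r_1$ be a vertex of degree $3$ in the complete bipartite graph $K_{2,3}$. Let $(T,r_2)$ be the rooted starlike tree $\mathcal{R}(K_{1,l}^{(k)},r_2)$: the root $r_2$ is adjacent to $k$ vertices $u_1,\dots,u_k$, and each $u_i$ is additionally adjacent to $l$ further leaves (distinct for different $i$). Let $G$ be the coalescence of $(K_{2,3},r_1)$ and $(T,r_2)$. Then all roots of $\pi(G,x)$ are purely imaginary if and only if one of the following holds: (1) $l\le 3$ and $l+k\ge 4$; (2) $l\ge 4$ and $k\ge 2l-4$.
   Context: For a finite simple graph $G$ with adjacency matrix $A(G)$, $\pi(G,x)=\operatorname{per}(xI-A(G))$ is its permanental polynomial, where $\operatorname{per}(M)=\sum_{\sigma\in S_n}\prod_i m_{i,\sigma(i)}$. The coalescence of rooted graphs $(G_1,r_1)$ and $(G_2,r_2)$ is obtained from their disjoint union by identifying $r_1$ with $r_2$. A complex number is purely imaginary if its real part is $0$ (including $0$). *)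

theory Defs
  imports
    Complex_Main
    "HOL-Combinatorics.Permutations"
    "HOL-Computational_Algebra.Polynomial"
    "Graph_Theory.Kuratowski"
begin

text \<open>
  Finite simple graphs are the digraphs satisfying the locale \<^locale>\<open>pair_graph\<close>: finite,
  loop-free and symmetric, with at most one arc from one vertex to another.  An edge
  \<open>uv\<close> is the pair of arcs \<open>(u, v)\<close>, \<open>(v, u)\<close>, so the degree of a vertex is its
  \<^const>\<open>out_degree\<close>.
\<close>

text \<open>
  Matrices are indexed by the vertices themselves; no enumeration of the vertices is chosen.
\<close>

definition permanent :: "'a set \<Rightarrow> ('a \<Rightarrow> 'a \<Rightarrow> 'b::comm_semiring_1) \<Rightarrow> 'b" where
  "permanent V M = (\<Sum>\<sigma> | \<sigma> permutes V. \<Prod>i\<in>V. M i (\<sigma> i))"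

definition adjacency_matrix :: "'a pair_pre_digraph \<Rightarrow> 'a \<Rightarrow> 'a \<Rightarrow> complex" where
  "adjacency_matrix G u v = (if (u, v) \<in> parcs G then 1 else 0)"

definition permanental_polynomial :: "'a pair_pre_digraph \<Rightarrow> complex poly" where
  "permanental_polynomial G =
     permanent (pverts G)
       (\<lambda>u v. (if u = v then [:0, 1:] else 0) - [:adjacency_matrix G u v:])"

definition purely_imaginary :: "complex \<Rightarrow> bool" where
  "purely_imaginary z \<longleftrightarrow> Re z = 0"

definition disjoint_union ::
  "'a pair_pre_digraph \<Rightarrow> 'b pair_pre_digraph \<Rightarrow> ('a + 'b) pair_pre_digraph" where
  "disjoint_union G H =
     \<lparr>pverts = Inl ` pverts G \<union> Inr ` pverts H,
      parcs = map_prod Inl Inl ` parcs G \<union> map_prod Inr Inr ` parcs H\<rparr>"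

text \<open>
  The merged vertex is represented by \<open>Inl r\<close>.
\<close>

definition identify_roots :: "'a \<Rightarrow> 'b \<Rightarrow> 'a + 'b \<Rightarrow> 'a + 'b" where
  "identify_roots r s w = (if w = Inr s then Inl r else w)"

definition coalescence ::
  "'a pair_pre_digraph \<Rightarrow> 'a \<Rightarrow> 'b pair_pre_digraph \<Rightarrow> 'b \<Rightarrow> ('a + 'b) pair_pre_digraph" where
  "coalescence G r H s =
     \<lparr>pverts = identify_roots r s ` pverts (disjoint_union G H),
      parcs = map_prod (identify_roots r s) (identify_roots r s) ` parcs (disjoint_union G H)\<rparr>"

datatype starlike_vertex = Root | Child nat | Leaf nat nat

text \<open>
  In \<open>starlike_tree k l\<close> the vertices \<open>u\<^sub>1, \<dots>, u\<^sub>k\<close> are \<open>Child 0, \<dots>, Child (k - 1)\<close>, and the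
  leaves attached to \<open>Child i\<close> are \<open>Leaf i 0, \<dots>, Leaf i (l - 1)\<close>.
\<close>

definition starlike_edges :: "nat \<Rightarrow> nat \<Rightarrow> starlike_vertex rel" where
  "starlike_edges k l =
     {(Root, Child i) |i. i < k} \<union> {(Child i, Leaf i j) |i j. i < k \<and> j < l}"

definition starlike_tree :: "nat \<Rightarrow> nat \<Rightarrow> starlike_vertex pair_pre_digraph" where
  "starlike_tree k l =
     \<lparr>pverts = {Root} \<union> {Child i |i. i < k} \<union> {Leaf i j |i j. i < k \<and> j < l},
      parcs = starlike_edges k l \<union> (starlike_edges k l)\<inverse>\<rparr>"

lemma pair_graph_iff:
  "pair_graph G \<longleftrightarrow>
     finite (pverts G) \<and> parcs G \<subseteq> pverts G \<times> pverts G \<and> sym (parcs G) \<and> irrefl (parcs G)"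
  (is "?L \<longleftrightarrow> ?R")
proof
  assume ?L
  then interpret pair_graph G .
  show ?R
    using pair_finite_verts arc_fst_in_verts arc_snd_in_verts pair_sym_arcs pair_no_loops
    by (fastforce simp: symmetric_def irrefl_def)
next
  assume R: ?R
  then have "finite (parcs G)"
    by (meson finite_SigmaI finite_subset)
  with R show ?L
    by unfold_locales (auto simp: symmetric_def irrefl_def)
qed

lemma pair_graph_starlike_tree: "pair_graph (starlike_tree k l)"
proof -
  have "{Leaf i j |i j. i < k \<and> j < l} = (\<lambda>(i, j). Leaf i j) ` ({..<k} \<times> {..<l})"
    by auto
  moreover have "{Child i |i. i < k} = Child ` {..<k}"
    by auto
  ultimately show ?thesis
    by (auto simp: pair_graph_iff starlike_tree_def starlike_edges_def sym_def irrefl_def)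
qed

lemma pair_graph_coalescence:
  assumes "pair_graph G" "pair_graph H"
  shows "pair_graph (coalescence G r H s)"
proof -
  let ?f = "identify_roots r s" and ?D = "disjoint_union G H"
  have G: "finite (pverts G)" "parcs G \<subseteq> pverts G \<times> pverts G" "sym (parcs G)" "irrefl (parcs G)"
    and H: "finite (pverts H)" "parcs H \<subseteq> pverts H \<times> pverts H" "sym (parcs H)" "irrefl (parcs H)"
    using assms(1,2) by (auto simp: pair_graph_iff)
  have "finite (pverts ?D)"
    using G(1) H(1) by (simp add: disjoint_union_def)
  moreover have "parcs ?D \<subseteq> pverts ?D \<times> pverts ?D"
    using G(2) H(2) by (auto simp: disjoint_union_def)
  then have "map_prod ?f ?f ` parcs ?D \<subseteq> ?f ` pverts ?D \<times> ?f ` pverts ?D"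
    by auto
  moreover have "sym (map_prod ?f ?f ` parcs ?D)"
  proof (rule symI)
    fix a b
    assume "(a, b) \<in> map_prod ?f ?f ` parcs ?D"
    then obtain x y where xy: "(x, y) \<in> parcs ?D" and ab: "a = ?f x" "b = ?f y"
      by auto
    have "(y, x) \<in> parcs ?D"
      using xy G(3) H(3) by (auto simp: disjoint_union_def dest: symD)
    then show "(b, a) \<in> map_prod ?f ?f ` parcs ?D"
      unfolding ab by (rule map_prod_imageI)
  qed
  moreover have "irrefl (map_prod ?f ?f ` parcs ?D)"
  proof (rule irreflI)
    fix a
    show "(a, a) \<notin> map_prod ?f ?f ` parcs ?D"
    proof
      assume "(a, a) \<in> map_prod ?f ?f ` parcs ?D"
      then obtain x y where "(x, y) \<in> parcs ?D" "?f x = ?f y"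
        by auto
      with G(4) H(4) show False
        by (auto simp: disjoint_union_def identify_roots_def irrefl_def split: if_splits)
    qed
  qed
  ultimately show ?thesis
    by (simp add: pair_graph_iff coalescence_def)
qed

end

theory Submission
  imports Defs "HOL-Computational_Algebra.Fundamental_Theorem_Algebra"
begin

text \<open>
  Deleting pendant vertices one at a time expresses the permanental polynomial of the coalescence
  through those of \<open>K\<^bsub>2,3\<^esub>\<close> and \<open>K\<^bsub>1,3\<^esub>\<close>.  For \<open>k \<ge> 1\<close> it equals \<open>S(x)\<^bsup>k-1\<^esup> x\<^bsup>l\<^esup> F(x\<^sup>2)\<close>, where
  \<open>S\<close> is the permanental polynomial of the star \<open>K\<^bsub>1,l\<^esub>\<close> and
  \<open>F(y) = (y + l)(y\<^sup>2 + 6 y + 12) + k y (y + 3)\<close>.  The roots of \<open>S\<close> are purely imaginary and \<open>F\<close>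
  has no positive root, so the question is whether \<open>F\<close> is real-rooted.  For \<open>l \<le> 3\<close> the condition
  of the theorem says \<open>F(- 4) \<ge> 0\<close>, for \<open>l \<ge> 4\<close> it says \<open>F(- 2) \<le> 0\<close>; either sign yields two
  distinct real roots, hence three.  If the condition fails, all real roots lie strictly on one side
  of \<open>- 3\<close>, which is incompatible with the linear coefficient \<open>3 - 3 k \<le> 0\<close> of \<open>F(t - 3)\<close>.
\<close>

subsection \<open>Permanents and pendant vertices\<close>

lemma permanent_empty [simp]: "permanent {} M = 1"
  by (simp add: permanent_def)

lemma permanent_cong:
  assumes "\<And>i j. i \<in> V \<Longrightarrow> j \<in> V \<Longrightarrow> M i j = N i j"
  shows "permanent V M = permanent V N"
  unfolding permanent_def
  by (intro sum.cong prod.cong refl) (auto simp: assms permutes_in_image)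

text \<open>Expansion along row \<open>v\<close>: a permutation of \<open>insert v V\<close> is
  uniquely a transposition of \<open>v\<close> with some \<open>u\<close> after a permutation
  \<open>q\<close> of \<open>V\<close>. The minor without row \<open>v\<close> and column
  \<open>u\<close> is kept on the index set \<open>V\<close> by letting column \<open>v\<close> take
  the place of column \<open>u\<close>.\<close>

lemma permanent_insert:
  assumes "finite V" "v \<notin> V"
  shows "permanent (insert v V) M =
    M v v * permanent V M + (\<Sum>u\<in>V. M v u * permanent V (\<lambda>i j. M i (if j = u then v else j)))"
proof -
  have term_eq: "(\<Prod>i\<in>insert v V. M i ((Transposition.transpose v u \<circ> q) i)) =
      M v u * (\<Prod>i\<in>V. M i (if q i = u then v else q i))"
    if "q permutes V" for u q
  proof -
    have "q v = v"
      using that assms(2) by (simp add: permutes_not_in)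
    moreover have "(\<Prod>i\<in>V. M i (Transposition.transpose v u (q i))) =
        (\<Prod>i\<in>V. M i (if q i = u then v else q i))"
    proof (rule prod.cong)
      fix i assume "i \<in> V"
      then have "q i \<noteq> v"
        using that assms(2) by (metis permutes_in_image)
      then show "M i (Transposition.transpose v u (q i)) = M i (if q i = u then v else q i)"
        by (simp add: Transposition.transpose_def)
    qed simp
    ultimately show ?thesis
      using assms by simp
  qed
  have "permanent (insert v V) M = (\<Sum>u\<in>insert v V. M v u *
      (\<Sum>q | q permutes V. \<Prod>i\<in>V. M i (if q i = u then v else q i)))"
    unfolding permanent_def sum_over_permutations_insert[OF assms] sum_distrib_left
    by (intro sum.cong refl term_eq) simp
  also have "\<dots> = M v v * (\<Sum>q | q permutes V. \<Prod>i\<in>V. M i (if q i = v then v else q i)) +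
      (\<Sum>u\<in>V. M v u * permanent V (\<lambda>i j. M i (if j = u then v else j)))"
    using assms by (simp add: permanent_def)
  also have "(\<Sum>q | q permutes V. \<Prod>i\<in>V. M i (if q i = v then v else q i)) = permanent V M"
    unfolding permanent_def by (intro sum.cong prod.cong) auto
  finally show ?thesis .
qed

lemma permanent_zero_column:
  assumes "finite V" "u \<in> V" "\<And>i. i \<in> V \<Longrightarrow> M i u = 0"
  shows "permanent V M = 0"
  unfolding permanent_def
proof (rule sum.neutral, rule ballI)
  fix \<sigma> assume "\<sigma> \<in> {\<sigma>. \<sigma> permutes V}"
  then have \<sigma>: "\<sigma> permutes V" by simp
  then obtain i where "i \<in> V" "\<sigma> i = u"
    using assms(2) by (metis permutes_image imageE)
  then show "(\<Prod>i\<in>V. M i (\<sigma> i)) = 0"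
    using assms by (auto intro!: prod_zero)
qed

lemma permanent_isolated:
  assumes "finite V" "v \<notin> V" "\<And>w. w \<in> V \<Longrightarrow> M v w = 0"
  shows "permanent (insert v V) M = M v v * permanent V M"
  using assms by (simp add: permanent_insert)

text \<open>Row \<open>v\<close> has entries only at \<open>v\<close> and \<open>u\<close>. In the
  minor for \<open>u\<close>, column \<open>u\<close> carries the entries of column
  \<open>v\<close>, which vanish outside row \<open>u\<close>; a second expansion, along row
  \<open>u\<close>, then removes \<open>u\<close> as well.\<close>

lemma permanent_pendant:
  assumes "finite V" "v \<notin> V" "u \<in> V"
    and "\<And>w. w \<in> V - {u} \<Longrightarrow> M v w = 0" "\<And>w. w \<in> V - {u} \<Longrightarrow> M w v = 0"
  shows "permanent (insert v V) M =
    M v v * permanent V M + M v u * M u v * permanent (V - {u}) M"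
proof -
  define N where "N = (\<lambda>i j. M i (if j = u then v else j))"
  have "permanent V N = permanent (insert u (V - {u})) N"
    using assms(3) by (simp add: insert_absorb)
  also have "\<dots> = N u u * permanent (V - {u}) N +
      (\<Sum>w\<in>V - {u}. N u w * permanent (V - {u}) (\<lambda>i j. N i (if j = w then u else j)))"
    using assms(1) by (intro permanent_insert) auto
  also have "(\<Sum>w\<in>V - {u}. N u w * permanent (V - {u}) (\<lambda>i j. N i (if j = w then u else j))) = 0"
  proof (rule sum.neutral, rule ballI)
    fix w assume w: "w \<in> V - {u}"
    \<comment> \<open>Column \<open>w\<close> of this minor holds the entries \<open>M i v\<close>
      with \<open>i\<close> different from \<open>u\<close>, all of them zero.\<close>
    then have "permanent (V - {u}) (\<lambda>i j. N i (if j = w then u else j)) = 0"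
      using assms(1,5) by (intro permanent_zero_column[of _ w]) (auto simp: N_def)
    then show "N u w * permanent (V - {u}) (\<lambda>i j. N i (if j = w then u else j)) = 0"
      by simp
  qed
  also have "permanent (V - {u}) N = permanent (V - {u}) M"
    by (rule permanent_cong) (auto simp: N_def)
  finally have "permanent V N = M u v * permanent (V - {u}) M"
    by (simp add: N_def)
  moreover have "(\<Sum>w\<in>V. M v w * permanent V (\<lambda>i j. M i (if j = w then v else j))) =
      (\<Sum>w\<in>{u}. M v w * permanent V (\<lambda>i j. M i (if j = w then v else j)))"
    using assms by (intro sum.mono_neutral_right) auto
  ultimately show ?thesis
    using assms(1,2) by (simp add: permanent_insert N_def mult.assoc)
qed

lemma permanent_isolated_set:
  assumes "finite L" "finite V" "L \<inter> V = {}"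
    and "\<And>v. v \<in> L \<Longrightarrow> M v v = x"
    and "\<And>v w. v \<in> L \<Longrightarrow> w \<in> L \<union> V \<Longrightarrow> w \<noteq> v \<Longrightarrow> M v w = 0"
  shows "permanent (L \<union> V) M = x ^ card L * permanent V M"
  using assms
proof (induction L rule: finite_induct)
  case (insert v L)
  have "permanent (insert v (L \<union> V)) M = M v v * permanent (L \<union> V) M"
    using insert by (intro permanent_isolated) auto
  with insert show ?case
    by (simp add: mult.assoc)
qed simp

text \<open>Leaves at a common neighbour \<open>u\<close> are removed one by one. Whenever
  \<open>u\<close> is deleted too, the remaining leaves become isolated and contribute only a power
  of \<open>x\<close>.\<close>

lemma permanent_pendant_set:
  fixes M :: "'a \<Rightarrow> 'a \<Rightarrow> 'b::comm_semiring_1"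
  assumes "finite L" "finite V" "L \<inter> V = {}" "u \<in> V"
    and "\<And>v. v \<in> L \<Longrightarrow> M v v = x" "\<And>v. v \<in> L \<Longrightarrow> M v u * M u v = 1"
    and "\<And>v w. v \<in> L \<Longrightarrow> w \<in> L \<union> V \<Longrightarrow> w \<noteq> v \<Longrightarrow> w \<noteq> u \<Longrightarrow> M v w = 0 \<and> M w v = 0"
  shows "permanent (L \<union> V) M = x ^ card L * permanent V M +
    of_nat (card L) * x ^ (card L - 1) * permanent (V - {u}) M"
  using assms
proof (induction L rule: finite_induct)
  case (insert v L)
  have "u \<notin> L" "\<And>w. w \<in> L \<Longrightarrow> w \<noteq> u"
    using insert.prems by auto
  then have eq: "L \<union> V - {u} = L \<union> (V - {u})"
    by auto
  have "permanent (insert v (L \<union> V)) M =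
      M v v * permanent (L \<union> V) M + M v u * M u v * permanent (L \<union> V - {u}) M"
    using insert by (intro permanent_pendant) auto
  moreover have "permanent (L \<union> V - {u}) M = x ^ card L * permanent (V - {u}) M"
    unfolding eq using insert \<open>\<And>w. w \<in> L \<Longrightarrow> w \<noteq> u\<close>
    by (intro permanent_isolated_set) auto
  moreover have "M v v = x" "M v u * M u v = 1"
    using insert.prems by auto
  ultimately have *: "permanent (insert v (L \<union> V)) M =
      x * permanent (L \<union> V) M + x ^ card L * permanent (V - {u}) M"
    by simp
  have "permanent (L \<union> V) M = x ^ card L * permanent V M +
      of_nat (card L) * x ^ (card L - 1) * permanent (V - {u}) M"
    using insert by (intro insert.IH) auto
  \<comment> \<open>The case split separates \<open>card L = 0\<close>, where the exponent
    \<open>card L - 1\<close> is truncated and the summand is killed by its coefficient.\<close>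
  with * insert.hyps show ?case
    by (cases "card L") (simp_all add: algebra_simps)
qed simp

text \<open>
  The summand \<open>of_nat n * x ^ (n - 1)\<close> vanishes for \<open>n = 0\<close>, whatever the truncated exponent.
\<close>

definition star_poly :: "nat \<Rightarrow> 'b::comm_semiring_1 \<Rightarrow> 'b" where
  "star_poly n x = x ^ Suc n + of_nat n * x ^ (n - 1)"

text \<open>The extra factor \<open>x\<close> removes the truncated exponent and exposes the zeros
  of the star polynomial.\<close>

lemma mult_star_poly: "x * star_poly n x = x ^ n * (x\<^sup>2 + of_nat n)"
  by (cases n) (simp_all add: star_poly_def algebra_simps power2_eq_square)

text \<open>One branch of the tree: a centre \<open>c\<close> with leaves \<open>L\<close>, joined
  to the rest only at \<open>r\<close>. After its leaves are stripped, \<open>c\<close> is pendant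
  at \<open>r\<close>, or isolated if \<open>r\<close> has already been deleted; both situations
  occur later.\<close>

lemma permanent_star:
  fixes M :: "'a \<Rightarrow> 'a \<Rightarrow> 'b::comm_semiring_1"
  assumes "finite L" "finite V" "c \<notin> V" "L \<inter> insert c V = {}"
    and "\<And>v. v \<in> insert c L \<Longrightarrow> M v v = x" "\<And>v. v \<in> L \<Longrightarrow> M v c * M c v = 1"
    and "\<And>v w. v \<in> L \<Longrightarrow> w \<in> L \<union> V \<Longrightarrow> w \<noteq> v \<Longrightarrow> M v w = 0 \<and> M w v = 0"
    and "\<And>w. w \<in> V \<Longrightarrow> w \<noteq> r \<Longrightarrow> M c w = 0 \<and> M w c = 0"
    and "M c r * M r c = 1"
  shows "permanent (L \<union> insert c V) M = star_poly (card L) x * permanent V M +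
    (if r \<in> V then x ^ card L * permanent (V - {r}) M else 0)"
proof -
  have "permanent (L \<union> insert c V) M = x ^ card L * permanent (insert c V) M +
      of_nat (card L) * x ^ (card L - 1) * permanent (insert c V - {c}) M"
    using assms by (intro permanent_pendant_set) auto
  moreover have "insert c V - {c} = V"
    using assms(3) by auto
  moreover have "permanent (insert c V) M =
      x * permanent V M + (if r \<in> V then permanent (V - {r}) M else 0)"
  proof (cases "r \<in> V")
    case True
    then have "permanent (insert c V) M =
        M c c * permanent V M + M c r * M r c * permanent (V - {r}) M"
      using assms(2,3,8) by (intro permanent_pendant) auto
    with True assms(5,9) show ?thesis by simp
  next
    case False
    then have "permanent (insert c V) M = M c c * permanent V M"
      using assms(2,3,8) by (intro permanent_isolated) auto
    with False assms(5) show ?thesis by simp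
  qed
  ultimately show ?thesis
    by (simp add: star_poly_def algebra_simps)
qed

text \<open>The root \<open>r\<close> lies in the part of size 2, so the second minor belongs to the
  star with three leaves. Once the five vertices are named, row expansion is a finite
  computation.\<close>

lemma permanent_K23:
  fixes M :: "'a \<Rightarrow> 'a \<Rightarrow> 'b::comm_ring_1"
  assumes "U \<inter> W = {}" "card U = 2" "card W = 3"
    and "\<And>v. v \<in> U \<union> W \<Longrightarrow> M v v = x"
    and "\<And>u v. u \<in> U \<Longrightarrow> v \<in> W \<Longrightarrow> M u v = - 1 \<and> M v u = - 1"
    and "\<And>u v. u \<in> U \<Longrightarrow> v \<in> U \<Longrightarrow> u \<noteq> v \<Longrightarrow> M u v = 0"
    and "\<And>u v. u \<in> W \<Longrightarrow> v \<in> W \<Longrightarrow> u \<noteq> v \<Longrightarrow> M u v = 0"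
    and "r \<in> U"
  shows "permanent (U \<union> W) M = x ^ 5 + 6 * x ^ 3 + 12 * x"
    and "permanent (U \<union> W - {r}) M = x ^ 4 + 3 * x\<^sup>2"
proof -
  obtain b where U: "U = {r, b}" "r \<noteq> b"
    using assms(2,8) by (auto simp: card_2_iff)
  obtain c d e where W: "W = {c, d, e}" "c \<noteq> d" "c \<noteq> e" "d \<noteq> e"
    using assms(3) by (auto simp: card_3_iff)
  have neq: "r \<noteq> c" "r \<noteq> d" "r \<noteq> e" "b \<noteq> c" "b \<noteq> d" "b \<noteq> e"
    using assms(1) U W by auto
  note neqs = neq U(2) W(2-4) neq[symmetric] U(2)[symmetric] W(2-4)[symmetric]
  have M: "M r r = x" "M b b = x" "M c c = x" "M d d = x" "M e e = x"
    "M r b = 0" "M b r = 0" "M c d = 0" "M c e = 0" "M d c = 0" "M d e = 0" "M e c = 0" "M e d = 0"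
    "M r c = - 1" "M r d = - 1" "M r e = - 1" "M b c = - 1" "M b d = - 1" "M b e = - 1"
    "M c r = - 1" "M d r = - 1" "M e r = - 1" "M c b = - 1" "M d b = - 1" "M e b = - 1"
    using assms(4-7) neqs U W by auto
  have sets: "U \<union> W = {c, d, e, r, b}" "U \<union> W - {r} = {c, d, e, b}"
    using U W neqs by auto
  show "permanent (U \<union> W) M = x ^ 5 + 6 * x ^ 3 + 12 * x"
    unfolding sets(1) by (simp add: permanent_insert neqs M, simp add: algebra_simps eval_nat_numeral)
  show "permanent (U \<union> W - {r}) M = x ^ 4 + 3 * x\<^sup>2"
    unfolding sets(2) by (simp add: permanent_insert neqs M, simp add: algebra_simps eval_nat_numeral)
qed

subsection \<open>Permanental polynomials of coalescences with starlike trees\<close>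

definition characteristic_matrix :: "'a pair_pre_digraph \<Rightarrow> 'a \<Rightarrow> 'a \<Rightarrow> complex poly" where
  "characteristic_matrix G u v = (if u = v then [:0, 1:] else 0) - [:adjacency_matrix G u v:]"

lemma permanental_polynomial_eq:
  "permanental_polynomial G = permanent (pverts G) (characteristic_matrix G)"
  by (simp add: permanental_polynomial_def characteristic_matrix_def[abs_def])

lemma characteristic_matrix_simps:
  "(u, u) \<notin> parcs G \<Longrightarrow> characteristic_matrix G u u = [:0, 1:]"
  "u \<noteq> v \<Longrightarrow> (u, v) \<in> parcs G \<Longrightarrow> characteristic_matrix G u v = - 1"
  "u \<noteq> v \<Longrightarrow> (u, v) \<notin> parcs G \<Longrightarrow> characteristic_matrix G u v = 0"
  by (simp_all add: characteristic_matrix_def adjacency_matrix_def one_pCons)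

text \<open>The nine cases cover all pairs formed from vertices of \<open>K\<close>, children and
  leaves. \<open>Inr Root\<close> is absent because it is merged into \<open>Inl r\<close>.\<close>

lemma parcs_coalescence_starlike:
  fixes r k l K
  defines "G \<equiv> coalescence K r (starlike_tree k l) Root"
  shows "(Inl u, Inl v) \<in> parcs G \<longleftrightarrow> (u, v) \<in> parcs K"
    and "(Inl u, Inr (Child i)) \<in> parcs G \<longleftrightarrow> u = r \<and> i < k"
    and "(Inr (Child i), Inl u) \<in> parcs G \<longleftrightarrow> u = r \<and> i < k"
    and "(Inl u, Inr (Leaf i j)) \<notin> parcs G"
    and "(Inr (Leaf i j), Inl u) \<notin> parcs G"
    and "(Inr (Child i), Inr (Child i')) \<notin> parcs G"
    and "(Inr (Leaf i j), Inr (Leaf i' j')) \<notin> parcs G"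
    and "(Inr (Child i), Inr (Leaf i' j)) \<in> parcs G \<longleftrightarrow> i = i' \<and> i < k \<and> j < l"
    and "(Inr (Leaf i' j), Inr (Child i)) \<in> parcs G \<longleftrightarrow> i = i' \<and> i < k \<and> j < l"
proof -
  have G: "parcs G = map_prod Inl Inl ` parcs K
      \<union> {(Inl r, Inr (Child i)) |i. i < k} \<union> {(Inr (Child i), Inl r) |i. i < k}
      \<union> {(Inr (Child i), Inr (Leaf i j)) |i j. i < k \<and> j < l}
      \<union> {(Inr (Leaf i j), Inr (Child i)) |i j. i < k \<and> j < l}" (is "_ = ?R")
  proof (intro equalityI subsetI)
    fix e assume "e \<in> parcs G"
    then show "e \<in> ?R"
      by (auto simp: G_def coalescence_def disjoint_union_def identify_roots_def
          starlike_tree_def starlike_edges_def split: if_splits)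
  next
    let ?f = "identify_roots r Root"
    have K: "(Inl u, Inl v) \<in> parcs G" if "(u, v) \<in> parcs K" for u v
    proof -
      have "map_prod Inl Inl (u, v) \<in> parcs (disjoint_union K (starlike_tree k l))"
        unfolding disjoint_union_def using that by (simp del: map_prod_simp)
      from imageI[OF this, of "map_prod ?f ?f"] show ?thesis by (simp add: G_def coalescence_def identify_roots_def)
    qed
    have T: "(?f (Inr u), ?f (Inr v)) \<in> parcs G" if "(u, v) \<in> parcs (starlike_tree k l)" for u v
    proof -
      have "map_prod Inr Inr (u, v) \<in> parcs (disjoint_union K (starlike_tree k l))"
        unfolding disjoint_union_def using that by (simp del: map_prod_simp)
      from imageI[OF this, of "map_prod ?f ?f"] show ?thesis by (simp add: G_def coalescence_def)
    qed
    have "(Inl r, Inr (Child i)) \<in> parcs G" "(Inr (Child i), Inl r) \<in> parcs G" if "i < k" for i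
      using T[of Root "Child i"] T[of "Child i" Root] that
      by (simp_all add: identify_roots_def starlike_tree_def starlike_edges_def)
    moreover have "(Inr (Child i), Inr (Leaf i j)) \<in> parcs G" "(Inr (Leaf i j), Inr (Child i)) \<in> parcs G"
      if "i < k" "j < l" for i j
      using T[of "Child i" "Leaf i j"] T[of "Leaf i j" "Child i"] that
      by (simp_all add: identify_roots_def starlike_tree_def starlike_edges_def)
    moreover fix e assume "e \<in> ?R"
    ultimately show "e \<in> parcs G"
      using K by auto
  qed
  show "(Inl u, Inl v) \<in> parcs G \<longleftrightarrow> (u, v) \<in> parcs K"
    and "(Inl u, Inr (Child i)) \<in> parcs G \<longleftrightarrow> u = r \<and> i < k"
    and "(Inr (Child i), Inl u) \<in> parcs G \<longleftrightarrow> u = r \<and> i < k"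
    and "(Inl u, Inr (Leaf i j)) \<notin> parcs G"
    and "(Inr (Leaf i j), Inl u) \<notin> parcs G"
    and "(Inr (Child i), Inr (Child i')) \<notin> parcs G"
    and "(Inr (Leaf i j), Inr (Leaf i' j')) \<notin> parcs G"
    and "(Inr (Child i), Inr (Leaf i' j)) \<in> parcs G \<longleftrightarrow> i = i' \<and> i < k \<and> j < l"
    and "(Inr (Leaf i' j), Inr (Child i)) \<in> parcs G \<longleftrightarrow> i = i' \<and> i < k \<and> j < l"
    unfolding G by auto
qed

lemma pverts_coalescence_starlike:
  assumes "r \<in> pverts K"
  shows "pverts (coalescence K r (starlike_tree k l) Root) =
    Inl ` pverts K \<union> {Inr (Child i) |i. i < k} \<union> {Inr (Leaf i j) |i j. i < k \<and> j < l}"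
  using assms
  by (auto simp: coalescence_def disjoint_union_def identify_roots_def starlike_tree_def
      image_Un image_iff)

text \<open>Branches are attached one at a time, \<open>W n\<close> being \<open>K\<close> with the
  first \<open>n\<close> of them. Two sequences are followed, with and without the root: the second
  is geometric, and feeding it into the recursion of the first makes the result linear in the minor,
  with coefficient proportional to \<open>k\<close>.\<close>

lemma permanental_polynomial_coalescence_starlike:
  fixes K :: "'a pair_pre_digraph" and r :: 'a and k l :: nat
  defines "G \<equiv> coalescence K r (starlike_tree k l) Root"
  defines "x \<equiv> [:0, 1:] :: complex poly"
  assumes "pair_graph K" "r \<in> pverts K"
  shows "permanental_polynomial G =
    star_poly l x ^ k * permanent (Inl ` pverts K) (characteristic_matrix G) +
    of_nat k * x ^ l * star_poly l x ^ (k - 1) *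
      permanent (Inl ` (pverts K - {r})) (characteristic_matrix G)"
proof -
  define M where "M = characteristic_matrix G"
  define W :: "nat \<Rightarrow> ('a + starlike_vertex) set" where
    "W n = Inl ` pverts K \<union> {Inr (Child i) |i. i < n} \<union> {Inr (Leaf i j) |i j. i < n \<and> j < l}" for n
  have K: "finite (pverts K)" "irrefl (parcs K)"
    using assms(3) by (auto simp: pair_graph_iff)
  note arcs = parcs_coalescence_starlike[where K = K and r = r and k = k and l = l, folded G_def]
  have W_Suc: "W (Suc n) = (Inr \<circ> Leaf n) ` {..<l} \<union> insert (Inr (Child n)) (W n)" for n
    by (auto simp: W_def less_Suc_eq)
  have W_Suc': "W (Suc n) - {Inl r} =
      (Inr \<circ> Leaf n) ` {..<l} \<union> insert (Inr (Child n)) (W n - {Inl r})" for n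
    by (auto simp: W_Suc)
  have finite_W: "finite (W n)" for n
    using K(1) by (induction n) (simp_all add: W_Suc, simp add: W_def)
  have card: "card ((Inr \<circ> Leaf n) ` {..<l} :: ('a + starlike_vertex) set) = l" for n
    by (subst card_image) (auto intro: inj_onI)
  \<comment> \<open>\<open>V\<close> stays arbitrary below \<open>W n\<close> because both
    \<open>W n\<close> and \<open>W n - {Inl r}\<close> are needed.\<close>
  have star: "permanent ((Inr \<circ> Leaf n) ` {..<l} \<union> insert (Inr (Child n)) V) M =
      star_poly l x * permanent V M +
      (if Inl r \<in> V then x ^ l * permanent (V - {Inl r}) M else 0)"
    if "n < k" "V \<subseteq> W n" for n V
  proof -
    have V: "finite V" "Inr (Child n) \<notin> V"
      "(Inr \<circ> Leaf n) ` {..<l} \<inter> insert (Inr (Child n)) V = {}"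
      using that finite_subset[OF _ finite_W] by (auto simp: W_def)
    have diag: "M v v = x" if "v \<in> insert (Inr (Child n)) ((Inr \<circ> Leaf n) ` {..<l})" for v
      using that by (auto simp: M_def x_def characteristic_matrix_simps arcs)
    have edge: "M v (Inr (Child n)) * M (Inr (Child n)) v = 1" if "v \<in> (Inr \<circ> Leaf n) ` {..<l}" for v
      using that \<open>n < k\<close> by (auto simp: M_def characteristic_matrix_simps arcs)
    have leaf: "M v w = 0 \<and> M w v = 0"
      if "v \<in> (Inr \<circ> Leaf n) ` {..<l}" "w \<in> (Inr \<circ> Leaf n) ` {..<l} \<union> V" "w \<noteq> v" for v w
      unfolding M_def using that \<open>V \<subseteq> W n\<close>
      by (intro conjI characteristic_matrix_simps(3)) (auto simp: W_def arcs dest!: subsetD)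
    have child: "M (Inr (Child n)) w = 0 \<and> M w (Inr (Child n)) = 0" if "w \<in> V" "w \<noteq> Inl r" for w
      unfolding M_def using that \<open>V \<subseteq> W n\<close> V(2)
      by (intro conjI characteristic_matrix_simps(3)) (auto simp: W_def arcs dest!: subsetD)
    have root: "M (Inr (Child n)) (Inl r) * M (Inl r) (Inr (Child n)) = 1"
      using \<open>n < k\<close> by (simp add: M_def characteristic_matrix_simps arcs)
    show ?thesis
      using permanent_star[of "(Inr \<circ> Leaf n) ` {..<l}" V "Inr (Child n)" M x "Inl r"]
        V diag edge leaf child root card[of n]
      by simp
  qed
  have "Inl r \<in> W n" for n
    using assms(4) by (simp add: W_def)
  then have step: "permanent (W (Suc n)) M =
      star_poly l x * permanent (W n) M + x ^ l * permanent (W n - {Inl r}) M" if "n < k" for n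
    using star[OF that order_refl] by (simp only: W_Suc if_True)
  have step': "permanent (W (Suc n) - {Inl r}) M = star_poly l x * permanent (W n - {Inl r}) M"
    if "n < k" for n
    using star[OF that Diff_subset[of "W n" "{Inl r}"]] by (simp only: W_Suc') simp
  \<comment> \<open>Without the root the branches are separate components, each contributing one
    factor.\<close>
  have minor: "permanent (W n - {Inl r}) M = star_poly l x ^ n * permanent (W 0 - {Inl r}) M"
    if "n \<le> k" for n
    using that by (induction n) (simp_all add: step' mult.assoc)
  have "permanent (W n) M = star_poly l x ^ n * permanent (W 0) M +
      of_nat n * x ^ l * star_poly l x ^ (n - 1) * permanent (W 0 - {Inl r}) M"
    if "n \<le> k" for n
    using that
  proof (induction n)
    case (Suc n)
    then have eq: "permanent (W (Suc n)) M =
        star_poly l x * (star_poly l x ^ n * permanent (W 0) M +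
          of_nat n * x ^ l * star_poly l x ^ (n - 1) * permanent (W 0 - {Inl r}) M) +
        x ^ l * (star_poly l x ^ n * permanent (W 0 - {Inl r}) M)"
      using step[of n] minor[of n] by simp
    \<comment> \<open>The split on \<open>n\<close> handles the truncated exponent
      \<open>n - 1\<close> at \<open>n = 0\<close>.\<close>
    show ?case
      unfolding eq by (cases n) (simp_all add: algebra_simps)
  qed simp
  moreover have "W 0 - {Inl r} = Inl ` (pverts K - {r})" "W 0 = Inl ` pverts K"
    by (auto simp: W_def)
  moreover have "pverts G = W k"
    unfolding G_def W_def by (rule pverts_coalescence_starlike[OF assms(4)])
  ultimately show ?thesis
    by (simp add: permanental_polynomial_eq M_def)
qed

lemma permanental_polynomial_K23_coalescence_starlike:
  fixes K :: "'a pair_pre_digraph" and r :: 'a and k l :: nat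
  defines "G \<equiv> coalescence K r (starlike_tree k l) Root"
  defines "x \<equiv> [:0, 1:] :: complex poly"
  assumes "complete_bipartite_digraph 2 3 (with_proj K)" "r \<in> pverts K"
    and "out_degree (with_proj K) r = 3"
  shows "permanental_polynomial G =
    star_poly l x ^ k * (x ^ 5 + 6 * x ^ 3 + 12 * x) +
    of_nat k * x ^ l * star_poly l x ^ (k - 1) * (x ^ 4 + 3 * x\<^sup>2)"
proof -
  obtain U V where UV: "pverts K = U \<union> V" "U \<inter> V = {}" "card U = 2" "card V = 3"
    and arcs: "parcs K = U \<times> V \<union> V \<times> U"
    using assms(3) unfolding complete_bipartite_digraph_pair_def by blast
  have "r \<in> U"
  \<comment> \<open>A vertex of the part \<open>V\<close> of size 3 has only the two vertices of
    \<open>U\<close> as neighbours, so its degree is not 3.\<close>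
  proof (rule ccontr)
    assume "r \<notin> U"
    then have "out_arcs (with_proj K) r = {r} \<times> U"
      using assms(4) UV(1) arcs by (auto simp: out_arcs_def)
    then show False
      using assms(5) UV(3) by (simp add: out_degree_def card_cartesian_product)
  qed
  let ?M = "characteristic_matrix G"
  note arcs_G = arcs parcs_coalescence_starlike(1)[where K = K and r = r and k = k and l = l, folded G_def]
  have diag: "?M v v = x" if "v \<in> Inl ` U \<union> Inl ` V" for v
    unfolding x_def using that UV(2)
    by (intro characteristic_matrix_simps(1)) (auto simp: arcs_G)
  have edge: "?M u v = - 1 \<and> ?M v u = - 1" if "u \<in> Inl ` U" "v \<in> Inl ` V" for u v
    using that UV(2) by (intro conjI characteristic_matrix_simps(2)) (auto simp: arcs_G)
  have non_edge: "?M u v = 0"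
    if "u \<in> Inl ` U \<and> v \<in> Inl ` U \<or> u \<in> Inl ` V \<and> v \<in> Inl ` V" "u \<noteq> v" for u v
    using that UV(2) by (intro characteristic_matrix_simps(3)) (auto simp: arcs_G)
  have parts: "Inl ` U \<inter> Inl ` V = {}" "card (Inl ` U) = 2" "card (Inl ` V) = 3" "Inl r \<in> Inl ` U"
    using UV(2-4) \<open>r \<in> U\<close> by (auto simp: card_image)
  note K23 = permanent_K23[where M = ?M, OF parts(1-3) diag edge _ _ parts(4)]
  have "permanent (Inl ` U \<union> Inl ` V) ?M = x ^ 5 + 6 * x ^ 3 + 12 * x"
    by (rule K23(1)) (simp_all add: non_edge)
  moreover have "permanent (Inl ` U \<union> Inl ` V - {Inl r}) ?M = x ^ 4 + 3 * x\<^sup>2"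
    by (rule K23(2)) (simp_all add: non_edge)
  moreover have "Inl ` (pverts K - {r}) = (Inl ` U \<union> Inl ` V - {Inl r} :: ('a + starlike_vertex) set)"
    "Inl ` pverts K = (Inl ` U \<union> Inl ` V :: ('a + starlike_vertex) set)"
    by (auto simp: UV(1))
  moreover have "permanental_polynomial G =
      star_poly l x ^ k * permanent (Inl ` pverts K) ?M +
      of_nat k * x ^ l * star_poly l x ^ (k - 1) * permanent (Inl ` (pverts K - {r})) ?M"
    unfolding G_def x_def using pair_graphI_complete_bipartite[OF assms(3)] assms(4)
    by (rule permanental_polynomial_coalescence_starlike)
  ultimately show ?thesis
    by (simp only:)
qed

subsection \<open>Real-rootedness of the cubic factor\<close>

text \<open>One root comes from the fundamental theorem of algebra, the other two from the quadratic
  formula. The second elementary symmetric function of the roots is exported because its sign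
  decides the later contradiction.\<close>

lemma cubic_splits:
  fixes a b c :: complex
  obtains r s t where "b = r * s + r * t + s * t"
    "\<And>y. y ^ 3 + a * y\<^sup>2 + b * y + c = (y - r) * (y - s) * (y - t)"
proof -
  have "\<exists>r. poly [:c, b, a, 1:] r = 0"
    by (rule fundamental_theorem_of_algebra_alt) auto
  then obtain r where r: "c = - (r * (b + r * (a + r)))"
    by (auto simp: eq_neg_iff_add_eq_0 algebra_simps)
  \<comment> \<open>\<open>d\<close> is a square root of the discriminant of the quotient
    \<open>y^2 + (a + r) y + (b + r (a + r))\<close>, whose roots are \<open>s\<close> and
    \<open>t\<close>.\<close>
  define d where "d = csqrt ((a + r)\<^sup>2 - 4 * (b + r * (a + r)))"
  define s where "s = (- (a + r) + d) / 2"
  define t where "t = (- (a + r) - d) / 2"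
  have d: "d\<^sup>2 = (a + r)\<^sup>2 - 4 * (b + r * (a + r))"
    by (simp add: d_def)
  have "s + t = - (a + r)"
    by (simp add: s_def t_def field_simps)
  then have a: "a = - (r + s + t)"
    by (simp add: algebra_simps add_eq_0_iff)
  have "4 * (s * t) = (a + r)\<^sup>2 - d\<^sup>2"
    by (simp add: s_def t_def field_simps power2_eq_square)
  then have "4 * (s * t) = 4 * (b + r * (a + r))"
    by (simp only: d) simp
  then have "s * t = b + r * (a + r)"
    by (simp only: mult_cancel_left) simp
  with r have b: "b = r * s + r * t + s * t" and c: "c = - (r * s * t)"
    by (simp add: a algebra_simps, simp add: mult.assoc)
  show thesis
    by (rule that[OF b]) (simp add: a b c algebra_simps power2_eq_square power3_eq_cube)
qed

text \<open>Two distinct real roots determine the third as \<open>- a - r - s\<close>, which is real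
  again.\<close>

lemma real_rooted_cubic:
  fixes a b c r s :: real
  assumes "r \<noteq> s" "r ^ 3 + a * r\<^sup>2 + b * r + c = 0" "s ^ 3 + a * s\<^sup>2 + b * s + c = 0"
    and y: "y ^ 3 + of_real a * y\<^sup>2 + of_real b * y + of_real c = (0 :: complex)"
  shows "y \<in> \<real>"
proof -
  \<comment> \<open>Difference of the two root equations; cancelling \<open>r - s\<close> yields
    \<open>b\<close>.\<close>
  have "(r - s) * (r\<^sup>2 + r * s + s\<^sup>2 + a * (r + s) + b) = 0"
    using assms(2,3) by (simp add: algebra_simps power2_eq_square power3_eq_cube)
  then have b: "b = - (r\<^sup>2 + r * s + s\<^sup>2 + a * (r + s))"
    using assms(1) by simp
  have c: "c = - (r ^ 3 + a * r\<^sup>2 + b * r)"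
    using assms(2) by simp
  have "y ^ 3 + of_real a * y\<^sup>2 + of_real b * y + of_real c =
      (y - of_real r) * (y - of_real s) * (y - of_real (- a - r - s))"
    by (simp add: b c algebra_simps power2_eq_square power3_eq_cube)
  with y have "y = of_real r \<or> y = of_real s \<or> y = of_real (- a - r - s)"
    by simp
  then show ?thesis
    by auto
qed

text \<open>Generic in the ring: signs are studied over the reals, roots over the complex
  numbers.\<close>

definition cubic_factor :: "nat \<Rightarrow> nat \<Rightarrow> 'a::comm_ring_1 \<Rightarrow> 'a" where
  "cubic_factor k l y = (y + of_nat l) * (y\<^sup>2 + 6 * y + 12) + of_nat k * y * (y + 3)"

lemma cubic_factor_expand:
  "cubic_factor k l y = y ^ 3 + (of_nat l + of_nat k + 6) * y\<^sup>2 +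
    (6 * of_nat l + 3 * of_nat k + 12) * y + 12 * of_nat l"
  by (simp add: cubic_factor_def algebra_simps power2_eq_square power3_eq_cube)

lemma cubic_factor_of_real:
  "cubic_factor k l (of_real y :: complex) = of_real (cubic_factor k l y)"
  by (simp add: cubic_factor_def)

lemma cubic_factor_pos:
  assumes "y > (0::real)"
  shows "cubic_factor k l y > 0"
  using assms unfolding cubic_factor_def
  by (intro add_pos_nonneg mult_pos_pos) auto

text \<open>Supplies the left end point for the intermediate value theorem.\<close>

lemma cubic_factor_nonpos_left:
  obtains B where "\<And>y::real. y \<le> B \<Longrightarrow> cubic_factor k l y \<le> 0" "B \<le> - 4"
proof
  \<comment> \<open>The bound makes \<open>y + l\<close> at most \<open>- 4 k\<close>, and four
    times the quadratic \<open>y^2 + 6 y + 12\<close> dominates \<open>y (y + 3)\<close>. The final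
    4 in the bound secures \<open>B <= - 4\<close>.\<close>
  fix y :: real assume y: "y \<le> - (real l + 4 * real k + 4)"
  have "(y + l) * (y\<^sup>2 + 6 * y + 12) \<le> (- 4 * real k) * (y\<^sup>2 + 6 * y + 12)"
  proof (rule mult_right_mono)
    have "y\<^sup>2 + 6 * y + 12 = (y + 3)\<^sup>2 + 3"
      by (simp add: power2_eq_square algebra_simps)
    then show "0 \<le> y\<^sup>2 + 6 * y + 12"
      by (metis add_nonneg_nonneg zero_le_numeral zero_le_power2)
  qed (use y in simp)
  moreover have "real k * (4 * (y\<^sup>2 + 6 * y + 12) - y * (y + 3)) \<ge> 0"
  proof -
    have "4 * (y\<^sup>2 + 6 * y + 12) - y * (y + 3) = 3 * (y + 7 / 2)\<^sup>2 + 45 / 4"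
      by (simp add: power2_eq_square field_simps)
    then show ?thesis by simp
  qed
  ultimately show "cubic_factor k l y \<le> 0"
    by (simp add: cubic_factor_def algebra_simps)
qed simp

lemma isCont_cubic_factor: "isCont (cubic_factor k l) (y::real)"
  unfolding cubic_factor_def[abs_def] by (intro continuous_intros)

lemma cubic_factor_two_real_roots:
  assumes "(l \<le> 3 \<and> l + k \<ge> 4) \<or> (l \<ge> 4 \<and> int k \<ge> 2 * int l - 4)"
  obtains r s :: real where "r \<noteq> s" "cubic_factor k l r = 0" "cubic_factor k l s = 0"
proof -
  have ivt_up: "\<exists>y\<ge>a. y \<le> b \<and> cubic_factor k l y = 0"
    if "cubic_factor k l a \<le> 0" "cubic_factor k l b \<ge> 0" "a \<le> b" for a b :: real
    using that by (intro IVT) (auto simp: isCont_cubic_factor)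
  have ivt_down: "\<exists>y\<ge>a. y \<le> b \<and> cubic_factor k l y = 0"
    if "cubic_factor k l a \<ge> 0" "cubic_factor k l b \<le> 0" "a \<le> b" for a b :: real
    using that by (intro IVT2) (auto simp: isCont_cubic_factor)
  obtain B where B: "cubic_factor k l B \<le> 0" "B \<le> (- 4 :: real)"
    using cubic_factor_nonpos_left[of k l] by (metis order_refl)
  consider "l \<le> 3" "l + k \<ge> 4" | "l \<ge> 4" "int k \<ge> 2 * int l - 4"
    using assms by blast
  then show thesis
  proof cases
    \<comment> \<open>Weak signs at \<open>B\<close>, -4, -3, 0 are -, +, -, +; the roots found lie
      in the disjoint intervals from \<open>B\<close> to -4 and from -3 to 0.\<close>
    case 1
    have "cubic_factor k l (- 4 :: real) = 4 * (real (l + k) - 4)"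
      by (simp add: cubic_factor_def)
    moreover have "real (l + k) \<ge> 4"
      using 1 by linarith
    ultimately have "cubic_factor k l (- 4 :: real) \<ge> 0"
      by simp
    from ivt_up[OF B(1) this B(2)] obtain r :: real where r: "r \<le> - 4" "cubic_factor k l r = 0"
      by blast
    have "cubic_factor k l (- 3 :: real) \<le> 0" "cubic_factor k l (0 :: real) \<ge> 0"
      using 1(1) by (simp_all add: cubic_factor_def)
    from ivt_up[OF this] obtain s :: real where s: "s \<ge> - 3" "cubic_factor k l s = 0"
      by auto
    show thesis
      using r s by (intro that[of r s]) auto
  next
    \<comment> \<open>Signs at \<open>B\<close>, -3, -2 are -, +, -. Positivity at -3 is strict, so
      the roots found on either side of -3 are distinct.\<close>
    case 2
    have pos: "cubic_factor k l (- 3 :: real) > 0"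
      using 2(1) by (simp add: cubic_factor_def)
    have "B \<le> - 3"
      using B(2) by simp
    from ivt_up[OF B(1) less_imp_le[OF pos] this] obtain r :: real where r: "r \<le> - 3" "cubic_factor k l r = 0"
      by blast
    have "cubic_factor k l (- 2 :: real) = 4 * real l - 8 - 2 * real k"
      by (simp add: cubic_factor_def)
    moreover have "real k \<ge> 2 * real l - 4"
      using 2(2) by linarith
    ultimately have "cubic_factor k l (- 2 :: real) \<le> 0"
      by simp
    with ivt_down[of "- 3" "- 2"] pos obtain s :: real where s: "s \<ge> - 3" "cubic_factor k l s = 0"
      by auto
    have "r \<noteq> - 3"
      using r(2) pos by auto
    with r s show thesis
      by (intro that[of r s]) auto
  qed
qed

section \<open>Position of the real roots relative to -3 when the condition fails\<close>

lemma cubic_factor_shift: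
  "cubic_factor k l (t - 3) =
    t ^ 3 + (of_nat l + of_nat k - 3) * t\<^sup>2 + (3 - 3 * of_nat k) * t + 3 * (of_nat l - 3)"
  by (simp add: cubic_factor_def algebra_simps power2_eq_square power3_eq_cube)

lemma cubic_factor_roots_right:
  fixes t :: real
  assumes "l + k \<le> 3" "k \<ge> 1" "cubic_factor k l (t - 3) = 0"
  shows "t > 0"
proof (rule ccontr)
  assume "\<not> t > 0"
  define u where "u = - t"
  have u: "u \<ge> 0" and t: "t = - u"
    using \<open>\<not> t > 0\<close> by (simp_all add: u_def)
  \<comment> \<open>These squares express that \<open>u^3\<close> lies above its tangents at 3/2 and
    1 for \<open>u >= 0\<close>. With them the six possible pairs \<open>(l, k)\<close> are refuted
    by arithmetic linear in \<open>u\<close>, \<open>u^2\<close> and \<open>u^3\<close>; the tangent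
    at 3/2 serves \<open>l = 0\<close>, \<open>k = 3\<close>.\<close>
  have "(u - 3 / 2)\<^sup>2 * (u + 3) \<ge> 0" "(u - 1)\<^sup>2 * (u + 2) \<ge> 0"
    using u by auto
  moreover have "(u - 3 / 2)\<^sup>2 * (u + 3) = u ^ 3 - 27 / 4 * u + 27 / 4"
    "(u - 1)\<^sup>2 * (u + 2) = u ^ 3 - 3 * u + 2"
    by (simp_all add: power2_eq_square power3_eq_cube field_simps)
  ultimately have cubes: "u ^ 3 - 27 / 4 * u + 27 / 4 \<ge> 0" "u ^ 3 - 3 * u + 2 \<ge> 0" "u ^ 3 \<ge> 0"
    "u\<^sup>2 \<ge> 0"
    using u by simp_all
  have root: "u ^ 3 = (real l + real k - 3) * u\<^sup>2 - (3 - 3 * real k) * u + 3 * (real l - 3)"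
    using assms(3) unfolding cubic_factor_shift t by simp
  have "(l = 0 \<and> (k = 1 \<or> k = 2 \<or> k = 3)) \<or> (l = 1 \<and> (k = 1 \<or> k = 2)) \<or> (l = 2 \<and> k = 1)"
    using assms(1,2) by auto
  then show False
    by (elim disjE conjE) (use root u cubes in simp)+
qed

text \<open>For \<open>t > 3\<close> the cubic is positive. For \<open>t\<close> between 0 and 3 it
  decreases in \<open>k\<close>, so it suffices to look at the largest admissible value
  \<open>k = 2 l - 5\<close>, where it becomes a sum of nonnegative terms that do not vanish
  together.\<close>

lemma cubic_factor_roots_left:
  fixes t :: real
  assumes "l \<ge> 4" "k + 4 < 2 * l" "cubic_factor k l (t - 3) = 0"
  shows "t < 0"
proof (rule ccontr)
  assume "\<not> t < 0"
  then have t: "t \<ge> 0" by simp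
  show False
  proof (cases "t > 3")
    case True
    then show False
      using cubic_factor_pos[of "t - 3" k l] assms(3) by simp
  next
    case False
    define m where "m = real l - 3"
    have m: "m \<ge> 1" "real k \<le> 2 * m + 1"
      using assms(1,2) by (auto simp: m_def)
    have "real k * (t * (3 - t)) \<le> (2 * m + 1) * (t * (3 - t))"
      using m t False by (intro mult_right_mono) auto
    moreover have "cubic_factor k l (t - 3) =
        t ^ 3 + t\<^sup>2 + 3 * m * (t - 1)\<^sup>2 + (2 * m + 1) * (t * (3 - t)) - real k * (t * (3 - t))"
      unfolding cubic_factor_shift
      by (simp add: m_def algebra_simps power2_eq_square power3_eq_cube)
    ultimately have "t ^ 3 + t\<^sup>2 + 3 * m * (t - 1)\<^sup>2 \<le> 0"
      using assms(3) by simp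
    moreover have "t ^ 3 \<ge> 0" "t\<^sup>2 \<ge> 0" "3 * m * (t - 1)\<^sup>2 \<ge> 0"
      using t m by auto
    ultimately have "t\<^sup>2 = 0" "3 * m * (t - 1)\<^sup>2 = 0"
      by linarith+
    with m show False by auto
  qed
qed

text \<open>
  If all roots \<open>r\<close>, \<open>s\<close>, \<open>t\<close> of the shifted cubic are real, they lie on the same side of \<open>0\<close>,
  whereas \<open>r s + r t + s t = 3 - 3 k \<le> 0\<close>.
\<close>

lemma cubic_factor_not_real_rooted:
  assumes "k \<ge> 1" "\<not> ((l \<le> 3 \<and> l + k \<ge> 4) \<or> (l \<ge> 4 \<and> int k \<ge> 2 * int l - 4))"
  shows "\<exists>y::complex. cubic_factor k l y = 0 \<and> y \<notin> \<real>"
proof (rule ccontr)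
  assume "\<not> ?thesis"
  then have real: "y \<in> \<real>" if "cubic_factor k l y = 0" for y :: complex
    using that by blast
  obtain r s t :: complex where
    e2: "3 - 3 * of_nat k = r * s + r * t + s * t" and
    split: "\<And>y. y ^ 3 + (of_nat l + of_nat k - 3) * y\<^sup>2 + (3 - 3 * of_nat k) * y +
      3 * (of_nat l - 3) = (y - r) * (y - s) * (y - t)"
    by (rule cubic_splits[where a = "of_nat l + of_nat k - 3" and b = "3 - 3 * of_nat k"
          and c = "3 * (of_nat l - 3)"]) (rule that)
  have root: "cubic_factor k l (r - 3) = 0" "cubic_factor k l (s - 3) = 0" "cubic_factor k l (t - 3) = 0"
    unfolding cubic_factor_shift split by simp_all
  have "w \<in> \<real>" if "cubic_factor k l (w - 3) = 0" for w :: complex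
    using Reals_add[OF real[OF that], of 3] by simp
  then have "r \<in> \<real>" "s \<in> \<real>" "t \<in> \<real>"
    using root by blast+
  then obtain r' s' t' where real: "r = of_real r'" "s = of_real s'" "t = of_real t'"
    by (meson Reals_cases)
  have "cubic_factor k l (r' - 3) = 0" "cubic_factor k l (s' - 3) = 0" "cubic_factor k l (t' - 3) = 0"
    using root unfolding real by (simp_all flip: cubic_factor_of_real of_real_eq_0_iff[where 'a = complex])
  moreover have "l + k \<le> 3 \<or> (l \<ge> 4 \<and> k + 4 < 2 * l)"
    using assms by linarith
  ultimately have "(r' > 0 \<and> s' > 0 \<and> t' > 0) \<or> (r' < 0 \<and> s' < 0 \<and> t' < 0)"
    using assms(1) cubic_factor_roots_right cubic_factor_roots_left by blast
  then have "r' * s' + r' * t' + s' * t' > 0"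
    by (elim disjE; simp add: add_pos_pos mult_neg_neg)
  moreover have "of_real (3 - 3 * real k) = (of_real (r' * s' + r' * t' + s' * t') :: complex)"
    using e2 by (simp add: real)
  then have "3 - 3 * real k = r' * s' + r' * t' + s' * t'"
    by (simp only: of_real_eq_iff)
  ultimately show False
    using assms(1) by simp
qed

section \<open>From real roots \<open>y\<close> to purely imaginary \<open>z\<close> with
  \<open>z^2 = y\<close>\<close>

lemma Re_eq_0_iff_square: "Re z = 0 \<longleftrightarrow> z\<^sup>2 \<in> \<real> \<and> Re (z\<^sup>2) \<le> 0"
  by (auto simp: complex_is_Real_iff power2_eq_square mult_le_0_iff)

text \<open>Every complex \<open>y\<close> is a square, so purely imaginary \<open>z\<close> force
  all roots of the cubic to be real. Conversely, real roots are never positive, hence have purely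
  imaginary square roots.\<close>

lemma cubic_factor_purely_imaginary_iff:
  assumes "k \<ge> 1"
  shows "(\<forall>z::complex. cubic_factor k l (z\<^sup>2) = 0 \<longrightarrow> Re z = 0) \<longleftrightarrow>
    (l \<le> 3 \<and> l + k \<ge> 4) \<or> (l \<ge> 4 \<and> int k \<ge> 2 * int l - 4)" (is "?L \<longleftrightarrow> ?R")
proof
  assume ?L
  then have "y \<in> \<real>" if "cubic_factor k l y = 0" for y :: complex
    using that Re_eq_0_iff_square[of "csqrt y"] by (metis power2_csqrt)
  then show ?R
    using cubic_factor_not_real_rooted[OF assms] by blast
next
  assume ?R
  then obtain r s :: real where "r \<noteq> s" "cubic_factor k l r = 0" "cubic_factor k l s = 0"
    by (rule cubic_factor_two_real_roots)
  then have real: "y \<in> \<real>" if "cubic_factor k l y = 0" for y :: complex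
    using real_rooted_cubic[of r s "l + k + 6" "6 * l + 3 * k + 12" "12 * l" y] that
    by (simp add: cubic_factor_expand)
  show ?L
  proof (intro allI impI)
    fix z :: complex assume z: "cubic_factor k l (z\<^sup>2) = 0"
    then have "z\<^sup>2 \<in> \<real>"
      by (rule real)
    then obtain y where y: "z\<^sup>2 = of_real y"
      by (auto elim: Reals_cases)
    then have "cubic_factor k l y = 0"
      using z by (simp add: cubic_factor_of_real)
    then have "y \<le> 0"
      using cubic_factor_pos[of y k l] by force
    with y show "Re z = 0"
      by (simp add: Re_eq_0_iff_square)
  qed
qed

lemma Re_eq_0_if_star_poly_eq_0:
  assumes "star_poly n z = (0::complex)"
  shows "Re z = 0"
proof -
  have "z ^ n * (z\<^sup>2 + of_nat n) = 0"
    using assms by (simp flip: mult_star_poly)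
  then have "z = 0 \<or> z\<^sup>2 = of_real (- real n)"
    by (auto simp: add_eq_0_iff)
  then show ?thesis
    by (auto simp: Re_eq_0_iff_square)
qed

theorem theorem3p2:
  fixes k l :: nat
    and K :: "'a pair_pre_digraph"
    and r1 :: 'a
    and G :: "('a + starlike_vertex) pair_pre_digraph"
  assumes "complete_bipartite_digraph 2 3 (with_proj K)"
    and "r1 \<in> pverts K"
    and "out_degree (with_proj K) r1 = 3"
    and "G = coalescence K r1 (starlike_tree k l) Root"
  shows "(\<forall>z. poly (permanental_polynomial G) z = 0 \<longrightarrow> purely_imaginary z) \<longleftrightarrow>
    (l \<le> 3 \<and> l + k \<ge> 4) \<or> (l \<ge> 4 \<and> int k \<ge> 2 * int l - 4)"
proof -
  have star: "poly (star_poly l [:0, 1:]) z = star_poly l z" for z :: complex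
    by (simp add: star_poly_def)
  have poly_G: "poly (permanental_polynomial G) z =
      star_poly l z ^ k * (z * (z ^ 4 + 6 * z\<^sup>2 + 12)) +
      of_nat k * z ^ l * star_poly l z ^ (k - 1) * (z ^ 4 + 3 * z\<^sup>2)" for z
  proof -
    have "z ^ 5 + 6 * z ^ 3 + z * 12 = z * (z ^ 4 + 6 * z\<^sup>2 + 12)"
      by (simp add: algebra_simps eval_nat_numeral)
    then show ?thesis
      unfolding assms(4) permanental_polynomial_K23_coalescence_starlike[OF assms(1-3)]
      by (simp add: star)
  qed
  show ?thesis
  proof (cases "k = 0")
    case True
    \<comment> \<open>For \<open>k = 0\<close> both conditions fail, and the polynomial is that of
      \<open>K_{2,3}\<close> alone. \<open>w\<close> is a nonreal root of
      \<open>y^2 + 6 y + 12\<close>, so its square root is a root that is not purely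
      imaginary.\<close>
    define w where "w = Complex (- 3) (sqrt 3)"
    have "(csqrt w) ^ 4 = w\<^sup>2"
      using power_mult[of "csqrt w" 2 2] by simp
    moreover have "w\<^sup>2 + 6 * w + 12 = 0"
      by (simp add: w_def complex_eq_iff power2_eq_square)
    ultimately have "poly (permanental_polynomial G) (csqrt w) = 0"
      by (simp add: poly_G True)
    moreover have "Re (csqrt w) \<noteq> 0"
      by (simp add: Re_eq_0_iff_square w_def complex_is_Real_iff del: csqrt.sel)
    ultimately show ?thesis
      using True by (auto simp: purely_imaginary_def)
  next
    case False
    then obtain n where k: "k = Suc n"
      using not0_implies_Suc by blast
    have "poly (permanental_polynomial G) z =
        star_poly l z ^ n * (z ^ l * cubic_factor k l (z\<^sup>2))" for z
    proof -
      \<comment> \<open>The factor \<open>z\<close> of the polynomial of \<open>K_{2,3}\<close> is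
        kept next to \<open>star_poly l z\<close>, so that \<open>mult_star_poly\<close> turns the
        product into \<open>z^l (z^2 + l)\<close>.\<close>
      have "poly (permanental_polynomial G) z = star_poly l z ^ n *
          (z * star_poly l z * (z ^ 4 + 6 * z\<^sup>2 + 12) + of_nat k * z ^ l * (z ^ 4 + 3 * z\<^sup>2))"
        by (simp add: poly_G k algebra_simps)
      then show ?thesis
        by (simp add: mult_star_poly cubic_factor_def algebra_simps eval_nat_numeral)
    qed
    \<comment> \<open>The factors \<open>star_poly l z ^ n\<close> and \<open>z ^ l\<close> vanish
      only at purely imaginary points, which leaves the cubic.\<close>
    then have "(\<forall>z. poly (permanental_polynomial G) z = 0 \<longrightarrow> purely_imaginary z) \<longleftrightarrow>
        (\<forall>z::complex. cubic_factor k l (z\<^sup>2) = 0 \<longrightarrow> Re z = 0)"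
      by (auto simp: purely_imaginary_def dest: Re_eq_0_if_star_poly_eq_0)
    then show ?thesis
      using cubic_factor_purely_imaginary_iff[of k l] k by simp
  qed
qed

end
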